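(* Let $Y_1,Y_2$ be independent and identically distributed nonnegative random variables with distribution function $G$. (i) If $G$ is an $\mathcal{H}$-type distribution in tail beyond a point $c\in\mathbb{R}_{++}$, then $$\mathbb{P}(\theta_1Y_1+\theta_2Y_2>x)\ \ge\ \mathbb{P}(\eta_1Y_1+\eta_2Y_2>x),\quad x\ge c,$$ for all $\boldsymbol\theta=(\theta_1,\theta_2),\ \boldsymbol\eta=(\eta_1,\eta_2)\in\Delta_2$ such that $\boldsymbol\theta\prec_{\rm m}\boldsymbol\eta$. (ii) If $G$ is an $\mathcal{H}^\ast$-type distribution in tail beyond a point $c\in\mathbb{R}_{++}$, then for all $\boldsymbol\theta=(\theta_1,\theta_2)\in\Delta_2$, $$\mathbb{P}(\theta_1Y_1+\theta_2Y_2>x)\ \ge\ \mathbb{P}(Y_1>x),\quad x\ge c.$$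
   Context: $\mathbb{R}_{++}=(0,\infty)$ and $\Delta_2=\{(\theta_1,\theta_2)\in(0,1)^2:\theta_1+\theta_2=1\}$. For a distribution function $F$, $\overline F=1-F$. Classes: for a non-degenerate distribution function $F$ (not that of a constant) with $F(0-)=0$, $F\in\mathcal{H}$ if $x\mapsto\overline F(1/x)$ is concave on $\mathbb{R}_{++}$; $F\in\mathcal{H}^\ast$ if $x\mapsto\overline F(1/x)$ is subadditive on $\mathbb{R}_{++}$, i.e. $\overline F\left(\frac1{x+y}\right)\le\overline F\left(\frac1x\right)+\overline F\left(\frac1y\right)$ for all $x,y>0$. A distribution function $G$ with $G(0-)=0$ is an $\mathcal{H}$-type [resp. $\mathcal{H}^\ast$-type] distribution in tail beyond a point $c\in\mathbb{R}_{++}$ if there exists $F\in\mathcal{H}$ [resp. $F\in\mathcal{H}^\ast$] such that $\overline G(y)=\overline F(y)$ for all $y\ge c$. Majorization: for $\mathbf{a},\mathbf{b}\in\mathbb{R}^n$ with increasing rearrangements $a_{(1)}\le\cdots\le a_{(n)}$, $b_{(1)}\le\cdots\le b_{(n)}$, $\mathbf{a}\preceq_{\rm m}\mathbf{b}$ means $\sum_{i=1}^n a_{(i)}=\sum_{i=1}^n b_{(i)}$ and $\sum_{i=1}^j a_{(i)}\ge\sum_{i=1}^j b_{(i)}$ for $j=1,\ldots,n-1$; $\mathbf{a}\prec_{\rm m}\mathbf{b}$ means in addition that at least one of these inequalities is strict. *)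

theory Defs
  imports "HOL-Probability.Probability"
begin

definition distribution_function :: "(real \<Rightarrow> real) \<Rightarrow> bool" where
  "distribution_function F \<longleftrightarrow> (\<exists>N. real_distribution N \<and> F = cdf N)"

(* F(0-) = 0, where F(0-) is the left limit of F at 0. *)
definition nonneg_distribution_function :: "(real \<Rightarrow> real) \<Rightarrow> bool" where
  "nonneg_distribution_function F \<longleftrightarrow> distribution_function F \<and> (F \<longlongrightarrow> 0) (at_left 0)"

(* "return borel a" is the law of the constant a. *)
definition nondegenerate :: "(real \<Rightarrow> real) \<Rightarrow> bool" where
  "nondegenerate F \<longleftrightarrow> \<not> (\<exists>a. F = cdf (return borel a))"

definition tail :: "(real \<Rightarrow> real) \<Rightarrow> real \<Rightarrow> real" where
  "tail F x = 1 - F x"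

definition class_H :: "(real \<Rightarrow> real) set" where
  "class_H = {F. nonneg_distribution_function F \<and> nondegenerate F \<and>
                 concave_on {0<..} (\<lambda>x. tail F (1 / x))}"

definition class_H_star :: "(real \<Rightarrow> real) set" where
  "class_H_star = {F. nonneg_distribution_function F \<and> nondegenerate F \<and>
                      (\<forall>x>0. \<forall>y>0. tail F (1 / (x + y)) \<le> tail F (1 / x) + tail F (1 / y))}"

(* "tail_type C G c": G is of C-type in tail beyond the point c > 0. *)
definition tail_type :: "(real \<Rightarrow> real) set \<Rightarrow> (real \<Rightarrow> real) \<Rightarrow> real \<Rightarrow> bool" where
  "tail_type C G c \<longleftrightarrow> nonneg_distribution_function G \<and> 0 < c \<and>
     (\<exists>F\<in>C. \<forall>y\<ge>c. tail G y = tail F y)"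

definition Delta2 :: "(real \<times> real) set" where
  "Delta2 = {(\<theta>1, \<theta>2). \<theta>1 \<in> {0<..<1} \<and> \<theta>2 \<in> {0<..<1} \<and> \<theta>1 + \<theta>2 = 1}"

(* Vectors in R^n are lists of length n. "sort a" is the increasing rearrangement; list indices
   start at 0, so the sum over i < j is the sum of the j smallest entries. *)
definition majorized :: "real list \<Rightarrow> real list \<Rightarrow> bool" (infix \<open>\<preceq>\<^sub>m\<close> 50) where
  "a \<preceq>\<^sub>m b \<longleftrightarrow> length a = length b \<and>
     (\<Sum>i<length a. sort a ! i) = (\<Sum>i<length b. sort b ! i) \<and>
     (\<forall>j\<in>{1..<length a}. (\<Sum>i<j. sort a ! i) \<ge> (\<Sum>i<j. sort b ! i))"

definition strictly_majorized :: "real list \<Rightarrow> real list \<Rightarrow> bool" (infix \<open>\<prec>\<^sub>m\<close> 50) where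
  "a \<prec>\<^sub>m b \<longleftrightarrow> a \<preceq>\<^sub>m b \<and>
     (\<exists>j\<in>{1..<length a}. (\<Sum>i<j. sort a ! i) > (\<Sum>i<j. sort b ! i))"

end

theory Submission
  imports Defs
begin

text \<open>
  Write \<open>T\<close> for the tail of the common law \<open>\<nu>\<close> of \<open>Y1\<close> and \<open>Y2\<close>, and fix a level \<open>x \<ge> c\<close>. A convex
  combination \<open>\<theta>1 * Y1 + \<theta>2 * Y2\<close> exceeds \<open>x\<close> in three mutually exclusive ways: both variables exceed
  \<open>x\<close>, or exactly one of them does and is large enough to make up for the other. The first
  event does not depend on the weights. Conditioning on the value \<open>y \<le> x\<close> of the smaller variable
  (Fubini), the other two contribute together the integral over \<open>y \<le> x\<close> of
  \<open>T ((x - \<theta>2 * y) / \<theta>1) + T ((x - \<theta>1 * y) / \<theta>2)\<close>;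
  this is \<open>emeasure_weighted_sum_exceeds\<close>. For \<open>y \<ge> 0\<close> (almost surely the case) both statements then
  hold already for the integrands.

  Both arguments of \<open>T\<close> are at least \<open>x\<close>, hence at least \<open>c\<close>, so \<open>T\<close> may be replaced there by the tail
  of the distribution function \<open>F\<close> in \<open>\<H>\<close> or \<open>\<H>\<^sup>*\<close>. Put \<open>h z = tail F (1 / z)\<close>, a nondecreasing
  function, and \<open>u t = t / (x - (1 - t) * y)\<close>. The integrand is \<open>h (u \<theta>1) + h (u \<theta>2)\<close>.

  If \<open>h\<close> is subadditive, the integrand is at least \<open>h (u \<theta>1 + u \<theta>2)\<close>, and \<open>u \<theta>1 + u \<theta>2 \<ge> 1 / x\<close>, so it is
  at least \<open>T x\<close>, which is the corresponding integrand for the event that \<open>Y1\<close> exceeds \<open>x\<close>.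
  If \<open>h\<close> is concave, then \<open>h \<circ> u\<close> is concave because \<open>u\<close> is concave and \<open>h\<close> is nondecreasing; hence
  \<open>h (u t) + h (u (1 - t))\<close> can only grow when the pair of weights \<open>(t, 1 - t)\<close> becomes more balanced.
\<close>

section \<open>Tails at the reciprocal argument\<close>

lemma tail_antimono:
  assumes "distribution_function F" "a \<le> b"
  shows "tail F b \<le> tail F a"
proof -
  obtain N where "real_distribution N" "F = cdf N"
    using assms(1) by (auto simp: distribution_function_def)
  then interpret real_distribution N by simp
  show ?thesis
    using cdf_nondecreasing[OF assms(2)] \<open>F = cdf N\<close> by (simp add: tail_def)
qed

lemma weighted_threshold_ge:
  fixes x y :: real
  assumes "0 < \<theta>1" "\<theta>1 + \<theta>2 = 1" "0 < \<theta>2" "y \<le> x"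
  shows "x \<le> (x - \<theta>2 * y) / \<theta>1"
proof -
  have "\<theta>2 * y \<le> \<theta>2 * x"
    using assms by (intro mult_left_mono) auto
  moreover have "\<theta>1 * x + \<theta>2 * x = x"
    using assms(2) by (metis distrib_right mult_1)
  ultimately show ?thesis
    using assms(1) by (simp add: field_simps)
qed

text \<open>
  Because \<open>y \<ge> 0\<close>, the reciprocals \<open>\<theta>1 / (x - \<theta>2 * y)\<close> and \<open>\<theta>2 / (x - \<theta>1 * y)\<close> of the two thresholds
  sum to at least \<open>(\<theta>1 + \<theta>2) / x = 1 / x\<close>. Subadditivity at these reciprocals gives the bound.
\<close>

lemma subadditive_tail_threshold:
  fixes x y :: real
  assumes F: "F \<in> class_H_star"
    and \<theta>: "0 < \<theta>1" "0 < \<theta>2" "\<theta>1 + \<theta>2 = 1" and y: "0 \<le> y" "y \<le> x" "0 < x"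
  shows "tail F x \<le> tail F ((x - \<theta>2 * y) / \<theta>1) + tail F ((x - \<theta>1 * y) / \<theta>2)"
proof -
  have df: "distribution_function F"
    using F by (simp add: class_H_star_def nonneg_distribution_function_def)
  let ?a = "(x - \<theta>2 * y) / \<theta>1" and ?b = "(x - \<theta>1 * y) / \<theta>2"
  have pos: "0 < ?a" "0 < ?b"
    using weighted_threshold_ge[of \<theta>1 \<theta>2 y x] weighted_threshold_ge[of \<theta>2 \<theta>1 y x] \<theta> y by auto
  have "\<theta>1 / x \<le> 1 / ?a" "\<theta>2 / x \<le> 1 / ?b"
    using \<theta> y pos by (auto intro!: divide_left_mono mult_pos_pos simp: zero_less_divide_iff)
  then have "1 / x \<le> 1 / ?a + 1 / ?b"
    using \<theta>(3) by (metis add_divide_distrib add_mono)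
  then have "1 / (1 / ?a + 1 / ?b) \<le> 1 / (1 / x)"
    using y(3) pos by (intro divide_left_mono mult_pos_pos add_pos_pos zero_less_divide_1_iff[THEN iffD2]) auto
  then have "tail F x \<le> tail F (1 / (1 / ?a + 1 / ?b))"
    by (intro tail_antimono[OF df]) simp
  also have "\<dots> \<le> tail F (1 / (1 / ?a)) + tail F (1 / (1 / ?b))"
    using F pos unfolding class_H_star_def mem_Collect_eq by (meson zero_less_divide_1_iff)
  finally show ?thesis
    by simp
qed

text \<open>
  The reciprocal threshold has the form \<open>t / (a + b * t)\<close> with \<open>a = x - y\<close> and \<open>b = y\<close>. After clearing
  denominators the concavity defect is \<open>u * v * a * b * (s - t)\<^sup>2\<close>
  for the points \<open>s\<close>, \<open>t\<close> with weights \<open>u\<close>, \<open>v\<close>.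
\<close>

lemma concave_linear_fraction:
  fixes a b :: real
  assumes "0 \<le> a" "0 \<le> b" "0 < a + b"
  shows "concave_on {0<..} (\<lambda>t. t / (a + b * t))"
  unfolding concave_on_iff
proof (intro conjI ballI allI impI)
  show "convex {0::real<..}"
    by simp
next
  fix s t u v :: real
  assume s: "s \<in> {0<..}" and t: "t \<in> {0<..}" and uv: "0 \<le> u" "0 \<le> v" "u + v = 1"
  define p where "p = a + b * s"
  define q where "q = a + b * t"
  have pos: "0 < a + b * r" if "0 < r" for r
    using assms that by (cases "a = 0") (auto intro: add_pos_nonneg)
  have p: "0 < p" and q: "0 < q"
    using pos s t by (auto simp: p_def q_def)
  have v: "v = 1 - u"
    using uv by simp
  have r: "a + b * (u * s + v * t) = u * p + v * q"
    by (simp add: p_def q_def v algebra_simps)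
  have st: "0 < u * s + v * t"
    using s t uv by (metis add_pos_nonneg add_nonneg_pos greaterThan_iff less_le mult_eq_0_iff
        mult_pos_pos zero_neq_one add_0)
  then have rpos: "0 < u * p + v * q"
    using pos r by metis
  have "0 \<le> u * v * (a * b * (s - t)\<^sup>2)"
    using uv assms by simp
  also have "\<dots> = (u * s + v * t) * (p * q) - (u * s * q + v * t * p) * (u * p + v * q)"
    by (simp add: p_def q_def v power2_eq_square algebra_simps)
  finally have "(u * s * q + v * t * p) / (p * q) \<le> (u * s + v * t) / (u * p + v * q)"
    using p q rpos by (simp add: divide_le_eq le_divide_eq mult.commute)
  moreover have "(u * s * q + v * t * p) / (p * q) = u * (s / p) + v * (t / q)"
    using p q by (simp add: field_simps)
  ultimately show "u * (s / (a + b * s)) + v * (t / (a + b * t))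
      \<le> (u *\<^sub>R s + v *\<^sub>R t) / (a + b * (u *\<^sub>R s + v *\<^sub>R t))"
    by (simp add: r p_def q_def)
qed

lemma concave_tail_threshold:
  fixes x y :: real
  assumes F: "F \<in> class_H" and y: "0 \<le> y" "y \<le> x" "0 < x"
  shows "concave_on {0<..} (\<lambda>t. tail F ((x - (1 - t) * y) / t))"
  unfolding concave_on_iff
proof (intro conjI ballI allI impI)
  show "convex {0::real<..}"
    by simp
next
  fix s t u v :: real
  assume st: "s \<in> {0<..}" "t \<in> {0<..}" and uv: "0 \<le> u" "0 \<le> v" "u + v = 1"
  have df: "distribution_function F" and h: "concave_on {0<..} (\<lambda>z. tail F (1 / z))"
    using F by (auto simp: class_H_def nonneg_distribution_function_def)
  define w where "w r = r / ((x - y) + y * r)" for r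
  have w: "concave_on {0<..} w"
    unfolding w_def using y by (intro concave_linear_fraction) auto
  have w_pos: "0 < w r" if "0 < r" for r
    using that y unfolding w_def
    by (cases "y = x") (auto intro!: divide_pos_pos add_pos_nonneg)
  have eq: "(x - (1 - r) * y) / r = 1 / w r" for r
    by (simp add: w_def algebra_simps)
  have mem: "u *\<^sub>R s + v *\<^sub>R t \<in> {0<..}"
    using st uv by (intro convexD) auto
  have mem_w: "u *\<^sub>R w s + v *\<^sub>R w t \<in> {0<..}"
    using st uv w_pos by (intro convexD) auto
  have le: "u * w s + v * w t \<le> w (u *\<^sub>R s + v *\<^sub>R t)"
    using w st uv unfolding concave_on_iff by blast
  have "u * tail F (1 / w s) + v * tail F (1 / w t) \<le> tail F (1 / (u *\<^sub>R w s + v *\<^sub>R w t))"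
    using h st uv w_pos unfolding concave_on_iff by (meson greaterThan_iff)
  also have "\<dots> \<le> tail F (1 / w (u *\<^sub>R s + v *\<^sub>R t))"
    using le mem_w w_pos[of "u *\<^sub>R s + v *\<^sub>R t"] mem
    by (intro tail_antimono[OF df] divide_left_mono mult_pos_pos) auto
  finally show "u * tail F ((x - (1 - s) * y) / s) + v * tail F ((x - (1 - t) * y) / t)
      \<le> tail F ((x - (1 - (u *\<^sub>R s + v *\<^sub>R t)) * y) / (u *\<^sub>R s + v *\<^sub>R t))"
    by (simp only: eq)
qed

section \<open>Majorization of weight pairs\<close>

text \<open>
  The sums agree and \<open>min \<eta>1 \<eta>2 \<le> min \<theta>1 \<theta>2\<close>, so \<open>\<theta>1\<close> and \<open>\<theta>2\<close> lie between \<open>\<eta>1\<close> and \<open>\<eta>2\<close>, symmetrically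
  about their common mean.
\<close>

lemma majorized_pair_obtains_mixture:
  fixes \<theta>1 \<theta>2 \<eta>1 \<eta>2 :: real
  assumes "[\<theta>1, \<theta>2] \<preceq>\<^sub>m [\<eta>1, \<eta>2]"
  obtains u v where "0 \<le> u" "0 \<le> v" "u + v = 1"
    "\<theta>1 = u * \<eta>1 + v * \<eta>2" "\<theta>2 = v * \<eta>1 + u * \<eta>2"
proof -
  have sum: "\<theta>1 + \<theta>2 = \<eta>1 + \<eta>2" and min: "min \<eta>1 \<eta>2 \<le> min \<theta>1 \<theta>2"
    using assms by (auto simp: majorized_def numeral_2_eq_2 split: if_splits)
  show thesis
  proof (cases "\<eta>1 = \<eta>2")
    case True
    then show thesis
      using sum min that[of 1 0] by (auto simp: min_def split: if_splits)
  next
    case False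
    define u where "u = (\<theta>1 - \<eta>2) / (\<eta>1 - \<eta>2)"
    have u: "u * (\<eta>1 - \<eta>2) = \<theta>1 - \<eta>2"
      using False by (simp add: u_def)
    have "0 \<le> u" "u \<le> 1"
      using sum min False unfolding u_def
      by (auto simp: min_def divide_simps split: if_splits)
    moreover have "\<theta>1 = u * \<eta>1 + (1 - u) * \<eta>2"
      using u by (simp add: algebra_simps)
    moreover have "\<theta>2 = (1 - u) * \<eta>1 + u * \<eta>2"
      using u sum by (simp add: algebra_simps)
    ultimately show thesis
      using that[of u "1 - u"] by simp
  qed
qed

lemma concave_on_mixture_sum_le:
  fixes k :: "real \<Rightarrow> real"
  assumes k: "concave_on S k" and S: "\<eta>1 \<in> S" "\<eta>2 \<in> S"
    and "[\<theta>1, \<theta>2] \<preceq>\<^sub>m [\<eta>1, \<eta>2]"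
  shows "k \<eta>1 + k \<eta>2 \<le> k \<theta>1 + k \<theta>2"
proof -
  obtain u v where uv: "0 \<le> u" "0 \<le> v" "u + v = 1"
    and \<theta>: "\<theta>1 = u * \<eta>1 + v * \<eta>2" "\<theta>2 = v * \<eta>1 + u * \<eta>2"
    using majorized_pair_obtains_mixture[OF assms(4)] .
  have "u * k \<eta>1 + v * k \<eta>2 \<le> k \<theta>1" "v * k \<eta>1 + u * k \<eta>2 \<le> k \<theta>2"
    using k S uv unfolding concave_on_iff \<theta> by (auto simp: add.commute[of v u])
  then have "(u + v) * k \<eta>1 + (u + v) * k \<eta>2 \<le> k \<theta>1 + k \<theta>2"
    by (simp add: algebra_simps)
  then show ?thesis
    by (simp add: uv)
qed

section \<open>Exceedance of a weighted sum of two independent variables\<close>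

lemma (in prob_space) emeasure_indep_pair:
  assumes indep: "indep_var borel X borel Y" and A: "A \<in> sets (borel \<Otimes>\<^sub>M borel)"
  shows "emeasure M {\<omega>\<in>space M. (X \<omega>, Y \<omega>) \<in> A} =
      (\<integral>\<^sup>+y. emeasure (distr M borel X) {x. (x, y) \<in> A} \<partial>distr M borel Y)" (is "?l = ?r1")
    and "emeasure M {\<omega>\<in>space M. (X \<omega>, Y \<omega>) \<in> A} =
      (\<integral>\<^sup>+x. emeasure (distr M borel Y) {y. (x, y) \<in> A} \<partial>distr M borel X)" (is "_ = ?r2")
proof -
  have X[measurable]: "X \<in> borel_measurable M" and Y[measurable]: "Y \<in> borel_measurable M"
    and joint: "distr M borel X \<Otimes>\<^sub>M distr M borel Y = distr M (borel \<Otimes>\<^sub>M borel) (\<lambda>\<omega>. (X \<omega>, Y \<omega>))"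
    using indep unfolding indep_var_distribution_eq by auto
  interpret X: prob_space "distr M borel X" by (rule prob_space_distr) simp
  interpret Y: prob_space "distr M borel Y" by (rule prob_space_distr) simp
  interpret XY: pair_sigma_finite "distr M borel X" "distr M borel Y" ..
  have A': "A \<in> sets (distr M borel X \<Otimes>\<^sub>M distr M borel Y)"
    using A by (simp add: joint)
  have l: "?l = emeasure (distr M borel X \<Otimes>\<^sub>M distr M borel Y) A"
    unfolding joint using A
    by (subst emeasure_distr) (auto intro!: arg_cong[where f = "emeasure M"])
  show "?l = ?r1"
    unfolding l XY.emeasure_pair_measure_alt2[OF A'] by (simp add: vimage_def)
  show "?l = ?r2"
    unfolding l Y.emeasure_pair_measure_alt[OF A'] by (simp add: vimage_def)
qed

lemma (in real_distribution) emeasure_greaterThan_eq_tail: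
  "emeasure M {a<..} = ennreal (tail (cdf M) a)"
proof -
  have "tail (cdf M) a = measure M (UNIV - {..a})"
    using prob_compl[of "{..a}"] by (simp add: tail_def cdf_def)
  also have "UNIV - {..a} = {a<..}"
    by auto
  finally show ?thesis
    by (simp add: emeasure_eq_measure)
qed

lemma (in real_distribution) tail_cdf_nonneg: "0 \<le> tail (cdf M) a"
  by (simp add: tail_def cdf_def)

lemma (in real_distribution) borel_measurable_tail_cdf [measurable]:
  "tail (cdf M) \<in> borel_measurable borel"
  unfolding tail_def by (intro borel_measurable_diff borel_measurable_const borel_measurable_mono)
    (simp add: mono_def cdf_nondecreasing)

text \<open>
  The weighted sum cannot exceed \<open>x\<close> unless one variable does, so the events
  in which it exceeds \<open>x\<close> while \<open>Y2 \<le> x\<close>, respectively \<open>Y1 \<le> x\<close>, are disjoint. In the first one integrate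
  over the value of \<open>Y2\<close>, in the second one over the value of \<open>Y1\<close>.
\<close>

lemma (in prob_space) emeasure_weighted_sum_exceeds:
  fixes Y1 Y2 :: "'a \<Rightarrow> real"
  assumes indep: "indep_var borel Y1 borel Y2"
    and law: "distr M borel Y1 = \<nu>" "distr M borel Y2 = \<nu>"
    and \<theta>: "0 < \<theta>1" "0 < \<theta>2" "\<theta>1 + \<theta>2 = 1"
  shows "emeasure M {\<omega>\<in>space M. \<theta>1 * Y1 \<omega> + \<theta>2 * Y2 \<omega> > x} =
      emeasure M {\<omega>\<in>space M. Y1 \<omega> > x \<and> Y2 \<omega> > x} +
      (\<integral>\<^sup>+y. indicator {..x} y * ennreal (tail (cdf \<nu>) ((x - \<theta>2 * y) / \<theta>1)
          + tail (cdf \<nu>) ((x - \<theta>1 * y) / \<theta>2)) \<partial>\<nu>)"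
proof -
  have [measurable]: "Y1 \<in> borel_measurable M" "Y2 \<in> borel_measurable M"
    using indep unfolding indep_var_distribution_eq by auto
  interpret \<nu>: real_distribution \<nu>
    unfolding law(1)[symmetric] by (rule real_distribution_distr) simp
  let ?S = "\<lambda>\<omega>. \<theta>1 * Y1 \<omega> + \<theta>2 * Y2 \<omega>"
  let ?B = "{\<omega>\<in>space M. Y1 \<omega> > x \<and> Y2 \<omega> > x}"
  let ?A1 = "{(a, b). b \<le> x \<and> \<theta>1 * a + \<theta>2 * b > x} :: (real \<times> real) set"
  let ?A2 = "{(a, b). a \<le> x \<and> \<theta>1 * a + \<theta>2 * b > x} :: (real \<times> real) set"
  let ?E1 = "{\<omega>\<in>space M. (Y1 \<omega>, Y2 \<omega>) \<in> ?A1}"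
  let ?E2 = "{\<omega>\<in>space M. (Y1 \<omega>, Y2 \<omega>) \<in> ?A2}"
  have "?A1 = {p \<in> space (borel \<Otimes>\<^sub>M borel). snd p \<le> x \<and> \<theta>1 * fst p + \<theta>2 * snd p > x}"
    "?A2 = {p \<in> space (borel \<Otimes>\<^sub>M borel). fst p \<le> x \<and> \<theta>1 * fst p + \<theta>2 * snd p > x}"
    by (auto simp: space_pair_measure)
  then have A: "?A1 \<in> sets (borel \<Otimes>\<^sub>M borel)" "?A2 \<in> sets (borel \<Otimes>\<^sub>M borel)"
    by simp_all
  have x_eq: "\<theta>1 * x + \<theta>2 * x = x"
    using \<theta>(3) by (metis distrib_right mult_1)
  have small: "\<theta>1 * a + \<theta>2 * b \<le> x" if "a \<le> x" "b \<le> x" for a b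
    using that \<theta> x_eq by (metis add_mono less_imp_le mult_left_mono)
  have large: "\<theta>1 * a + \<theta>2 * b > x" if "a > x" "b > x" for a b
    using that \<theta> x_eq by (metis add_strict_mono mult_strict_left_mono)
  have split: "{\<omega>\<in>space M. ?S \<omega> > x} = ?B \<union> (?E1 \<union> ?E2)"
    using large by (auto simp: not_less)
  have disj: "?B \<inter> (?E1 \<union> ?E2) = {}" "?E1 \<inter> ?E2 = {}"
    using small by (auto simp: not_less[symmetric])
  have sec1: "{a. (a, b) \<in> ?A1} = (if b \<le> x then {(x - \<theta>2 * b) / \<theta>1<..} else {})" for b
    using \<theta> by (auto simp: field_simps)
  have sec2: "{b. (a, b) \<in> ?A2} = (if a \<le> x then {(x - \<theta>1 * a) / \<theta>2<..} else {})" for a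
    using \<theta> by (auto simp: field_simps)
  have E1: "emeasure M ?E1 =
      (\<integral>\<^sup>+y. indicator {..x} y * ennreal (tail (cdf \<nu>) ((x - \<theta>2 * y) / \<theta>1)) \<partial>\<nu>)"
    unfolding emeasure_indep_pair(1)[OF indep A(1)] law sec1
    by (intro nn_integral_cong) (simp add: \<nu>.emeasure_greaterThan_eq_tail indicator_def)
  have E2: "emeasure M ?E2 =
      (\<integral>\<^sup>+y. indicator {..x} y * ennreal (tail (cdf \<nu>) ((x - \<theta>1 * y) / \<theta>2)) \<partial>\<nu>)"
    unfolding emeasure_indep_pair(2)[OF indep A(2)] law sec2
    by (intro nn_integral_cong) (simp add: \<nu>.emeasure_greaterThan_eq_tail indicator_def)
  have sets: "?E1 \<in> sets M" "?E2 \<in> sets M" "?B \<in> sets M"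
    by measurable
  have "emeasure M {\<omega>\<in>space M. ?S \<omega> > x} = emeasure M ?B + (emeasure M ?E1 + emeasure M ?E2)"
    unfolding split using sets disj by (simp add: plus_emeasure[symmetric])
  also have "emeasure M ?E1 + emeasure M ?E2 =
      (\<integral>\<^sup>+y. indicator {..x} y * ennreal (tail (cdf \<nu>) ((x - \<theta>2 * y) / \<theta>1)
          + tail (cdf \<nu>) ((x - \<theta>1 * y) / \<theta>2)) \<partial>\<nu>)"
    unfolding E1 E2
    by (subst nn_integral_add[symmetric])
      (auto simp: \<nu>.tail_cdf_nonneg distrib_left intro!: nn_integral_cong)
  finally show ?thesis .
qed

lemma (in prob_space) emeasure_first_exceeds:
  fixes Y1 Y2 :: "'a \<Rightarrow> real"
  assumes indep: "indep_var borel Y1 borel Y2"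
    and law: "distr M borel Y1 = \<nu>" "distr M borel Y2 = \<nu>"
  shows "emeasure M {\<omega>\<in>space M. Y1 \<omega> > x} =
      emeasure M {\<omega>\<in>space M. Y1 \<omega> > x \<and> Y2 \<omega> > x} +
      (\<integral>\<^sup>+y. indicator {..x} y * ennreal (tail (cdf \<nu>) x) \<partial>\<nu>)"
proof -
  have [measurable]: "Y1 \<in> borel_measurable M" "Y2 \<in> borel_measurable M"
    using indep unfolding indep_var_distribution_eq by auto
  interpret \<nu>: real_distribution \<nu>
    unfolding law(1)[symmetric] by (rule real_distribution_distr) simp
  let ?B = "{\<omega>\<in>space M. Y1 \<omega> > x \<and> Y2 \<omega> > x}"
  let ?A = "{(a, b). b \<le> x \<and> a > x} :: (real \<times> real) set"
  let ?E = "{\<omega>\<in>space M. (Y1 \<omega>, Y2 \<omega>) \<in> ?A}"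
  have "?A = {p \<in> space (borel \<Otimes>\<^sub>M borel). snd p \<le> x \<and> fst p > x}"
    by (auto simp: space_pair_measure)
  then have A: "?A \<in> sets (borel \<Otimes>\<^sub>M borel)"
    by simp
  have sec: "{a. (a, b) \<in> ?A} = (if b \<le> x then {x<..} else {})" for b
    by auto
  have E: "emeasure M ?E = (\<integral>\<^sup>+y. indicator {..x} y * ennreal (tail (cdf \<nu>) x) \<partial>\<nu>)"
    unfolding emeasure_indep_pair(1)[OF indep A] law sec
    by (intro nn_integral_cong) (simp add: \<nu>.emeasure_greaterThan_eq_tail indicator_def)
  have sets: "?E \<in> sets M" "?B \<in> sets M"
    by measurable
  have "{\<omega>\<in>space M. Y1 \<omega> > x} = ?B \<union> ?E" "?B \<inter> ?E = {}"
    by (auto simp: not_less)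
  then show ?thesis
    using sets E by (simp add: plus_emeasure[symmetric])
qed

section \<open>The comparison of exceedance probabilities\<close>

theorem proposition4p3:
  fixes M :: "'a measure" and Y1 Y2 :: "'a \<Rightarrow> real" and G :: "real \<Rightarrow> real"
  assumes "prob_space M"
    and "Y1 \<in> borel_measurable M" and "Y2 \<in> borel_measurable M"
    and "prob_space.indep_var M borel Y1 borel Y2"
    and "AE \<omega> in M. 0 \<le> Y1 \<omega>" and "AE \<omega> in M. 0 \<le> Y2 \<omega>"
    and "cdf (distr M borel Y1) = G" and "cdf (distr M borel Y2) = G"
  shows
    "(\<forall>c>0. tail_type class_H G c \<longrightarrow>
        (\<forall>\<theta>1 \<theta>2 \<eta>1 \<eta>2. (\<theta>1, \<theta>2) \<in> Delta2 \<longrightarrow> (\<eta>1, \<eta>2) \<in> Delta2 \<longrightarrow> [\<theta>1, \<theta>2] \<prec>\<^sub>m [\<eta>1, \<eta>2] \<longrightarrow>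
          (\<forall>x\<ge>c. \<P>(\<omega> in M. \<theta>1 * Y1 \<omega> + \<theta>2 * Y2 \<omega> > x)
                \<ge> \<P>(\<omega> in M. \<eta>1 * Y1 \<omega> + \<eta>2 * Y2 \<omega> > x))))
     \<and>
     (\<forall>c>0. tail_type class_H_star G c \<longrightarrow>
        (\<forall>\<theta>1 \<theta>2. (\<theta>1, \<theta>2) \<in> Delta2 \<longrightarrow>
          (\<forall>x\<ge>c. \<P>(\<omega> in M. \<theta>1 * Y1 \<omega> + \<theta>2 * Y2 \<omega> > x)
                \<ge> \<P>(\<omega> in M. Y1 \<omega> > x))))"
proof -
  interpret prob_space M by fact
  define \<nu> where "\<nu> = distr M borel Y1"
  note [measurable] = assms(2,3)
  have law: "distr M borel Y1 = \<nu>" "distr M borel Y2 = \<nu>"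
    using assms(2,3,7,8) by (auto simp: \<nu>_def intro!: cdf_unique)
  have G: "G = cdf \<nu>"
    using assms(7) by (simp add: \<nu>_def)
  have AE_nonneg: "AE y in \<nu>. 0 \<le> y"
    unfolding \<nu>_def using assms(5) by (subst AE_distr_iff) auto
  note split = emeasure_weighted_sum_exceeds[OF assms(4) law, folded G]
  have from_emeasure: "prob A \<le> prob B" if "emeasure M A \<le> emeasure M B" for A B
    using that by (simp add: emeasure_eq_measure)
  have integral_mono: "(\<integral>\<^sup>+y. indicator {..x} y * ennreal (f y) \<partial>\<nu>)
      \<le> (\<integral>\<^sup>+y. indicator {..x} y * ennreal (g y) \<partial>\<nu>)"
    if "\<And>y. 0 \<le> y \<Longrightarrow> y \<le> x \<Longrightarrow> f y \<le> g y" for f g and x :: real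
    using AE_nonneg
    by (intro nn_integral_mono_AE, elim eventually_mono) (auto simp: indicator_def intro: ennreal_leI that)
  have tail_eq: "tail G ((x - \<theta>2 * y) / \<theta>1) = tail F ((x - \<theta>2 * y) / \<theta>1)"
    if "\<forall>z\<ge>c. tail G z = tail F z" "0 < \<theta>1" "0 < \<theta>2" "\<theta>1 + \<theta>2 = 1" "y \<le> x" "c \<le> x"
    for F c x y \<theta>1 \<theta>2
    using that weighted_threshold_ge[of \<theta>1 \<theta>2 y x] by force
  show ?thesis
  proof (intro conjI allI impI)
    fix c \<theta>1 \<theta>2 \<eta>1 \<eta>2 x :: real
    assume c: "0 < c" "c \<le> x" and type: "tail_type class_H G c"
      and "(\<theta>1, \<theta>2) \<in> Delta2" "(\<eta>1, \<eta>2) \<in> Delta2" and maj: "[\<theta>1, \<theta>2] \<prec>\<^sub>m [\<eta>1, \<eta>2]"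
    then have \<theta>: "0 < \<theta>1" "0 < \<theta>2" "\<theta>1 + \<theta>2 = 1" and \<eta>: "0 < \<eta>1" "0 < \<eta>2" "\<eta>1 + \<eta>2 = 1"
      by (auto simp: Delta2_def)
    obtain F where F: "F \<in> class_H" and GF: "\<forall>z\<ge>c. tail G z = tail F z"
      using type by (auto simp: tail_type_def)
    have "tail G ((x - \<eta>2 * y) / \<eta>1) + tail G ((x - \<eta>1 * y) / \<eta>2)
        \<le> tail G ((x - \<theta>2 * y) / \<theta>1) + tail G ((x - \<theta>1 * y) / \<theta>2)" if "0 \<le> y" "y \<le> x" for y
    proof -
      define k where "k t = tail F ((x - (1 - t) * y) / t)" for t
      have k: "tail G ((x - b * y) / a) = k a" if "0 < a" "0 < b" "a + b = 1" for a b
      proof -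
        have "1 - a = b"
          using that by simp
        then show ?thesis
          using tail_eq[OF GF that \<open>y \<le> x\<close> c(2)] by (simp add: k_def)
      qed
      have "concave_on {0<..} k"
        unfolding k_def using that c by (intro concave_tail_threshold[OF F]) auto
      then have "k \<eta>1 + k \<eta>2 \<le> k \<theta>1 + k \<theta>2"
        using \<eta> maj by (intro concave_on_mixture_sum_le) (auto simp: strictly_majorized_def)
      then show ?thesis
        using \<theta> \<eta> by (simp add: k add.commute)
    qed
    then show "\<P>(\<omega> in M. \<eta>1 * Y1 \<omega> + \<eta>2 * Y2 \<omega> > x) \<le> \<P>(\<omega> in M. \<theta>1 * Y1 \<omega> + \<theta>2 * Y2 \<omega> > x)"
      by (intro from_emeasure, unfold split[OF \<theta>] split[OF \<eta>])
        (intro add_left_mono integral_mono)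
  next
    fix c \<theta>1 \<theta>2 x :: real
    assume c: "0 < c" "c \<le> x" and type: "tail_type class_H_star G c" and "(\<theta>1, \<theta>2) \<in> Delta2"
    then have \<theta>: "0 < \<theta>1" "0 < \<theta>2" "\<theta>1 + \<theta>2 = 1"
      by (auto simp: Delta2_def)
    obtain F where F: "F \<in> class_H_star" and GF: "\<forall>z\<ge>c. tail G z = tail F z"
      using type by (auto simp: tail_type_def)
    have "tail G x \<le> tail G ((x - \<theta>2 * y) / \<theta>1) + tail G ((x - \<theta>1 * y) / \<theta>2)"
      if "0 \<le> y" "y \<le> x" for y
    proof -
      have "\<theta>2 + \<theta>1 = 1"
        using \<theta>(3) by simp
      then have "tail G ((x - \<theta>2 * y) / \<theta>1) = tail F ((x - \<theta>2 * y) / \<theta>1)"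
        "tail G ((x - \<theta>1 * y) / \<theta>2) = tail F ((x - \<theta>1 * y) / \<theta>2)" "tail G x = tail F x"
        using \<theta> that c GF by (auto intro!: tail_eq[OF GF])
      then show ?thesis
        using subadditive_tail_threshold[OF F \<theta> that] c by simp
    qed
    then show "\<P>(\<omega> in M. Y1 \<omega> > x) \<le> \<P>(\<omega> in M. \<theta>1 * Y1 \<omega> + \<theta>2 * Y2 \<omega> > x)"
      by (intro from_emeasure,
          unfold split[OF \<theta>] emeasure_first_exceeds[OF assms(4) law, folded G])
        (intro add_left_mono integral_mono)
  qed
qed

end
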